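(* If $(A,\rightarrow,\rightsquigarrow,1)$ is a commutative pseudo-BE algebra, then every deductive system of $A$ is fantastic, i.e. $\mathcal{DS}(A)=\mathcal{DS}_f(A)$.
   Context: A pseudo-BE algebra is an algebra $(A,\rightarrow,\rightsquigarrow,1)$ of type $(2,2,0)$ such that for all $x,y,z\in A$: $x\rightarrow x=x\rightsquigarrow x=1$; $x\rightarrow 1=x\rightsquigarrow 1=1$; $1\rightarrow x=1\rightsquigarrow x=x$; $x\rightarrow(y\rightsquigarrow z)=y\rightsquigarrow(x\rightarrow z)$; $x\rightarrow y=1$ iff $x\rightsquigarrow y=1$. Put $x\vee_1 y=(x\rightarrow y)\rightsquigarrow y$, $x\vee_2 y=(x\rightsquigarrow y)\rightarrow y$; $A$ is commutative if $x\vee_1 y=y\vee_1 x$ and $x\vee_2 y=y\vee_2 x$ for all $x,y$. $\mathcal{DS}(A)$ is the set of deductive systems: $D\subseteq A$ with $1\in D$ such that $x\in D$, $x\rightarrow y\in D$ imply $y\in D$. $\mathcal{DS}_f(A)$ is the set of fantastic ones: deductive systems $D$ such that for all $x,y$, $y\rightarrow x\in D$ implies $(x\vee_1 y)\rightarrow x\in D$ and $y\rightsquigarrow x\in D$ implies $(x\vee_2 y)\rightsquigarrow x\in D$. *)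

theory Defs
  imports Main
begin

text \<open>
  The algebra is given by an explicit carrier set, two operations and a constant.  The operations
  are total functions on the ambient type, so every axiom is relativised to the carrier.
\<close>

locale pseudo_BE_algebra =
  fixes A :: "'a set"
    and rimp :: "'a \<Rightarrow> 'a \<Rightarrow> 'a" (infixr "\<rightarrow>" 60)
    and limp :: "'a \<Rightarrow> 'a \<Rightarrow> 'a" (infixr "\<leadsto>" 60)
    and top_el :: 'a ("\<one>")
  assumes rimp_closed: "\<lbrakk>x \<in> A; y \<in> A\<rbrakk> \<Longrightarrow> x \<rightarrow> y \<in> A"
    and limp_closed: "\<lbrakk>x \<in> A; y \<in> A\<rbrakk> \<Longrightarrow> x \<leadsto> y \<in> A"
    and one_closed: "\<one> \<in> A"
    and rimp_refl: "x \<in> A \<Longrightarrow> x \<rightarrow> x = \<one>"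
    and limp_refl: "x \<in> A \<Longrightarrow> x \<leadsto> x = \<one>"
    and rimp_one: "x \<in> A \<Longrightarrow> x \<rightarrow> \<one> = \<one>"
    and limp_one: "x \<in> A \<Longrightarrow> x \<leadsto> \<one> = \<one>"
    and one_rimp: "x \<in> A \<Longrightarrow> \<one> \<rightarrow> x = x"
    and one_limp: "x \<in> A \<Longrightarrow> \<one> \<leadsto> x = x"
    and exchange: "\<lbrakk>x \<in> A; y \<in> A; z \<in> A\<rbrakk> \<Longrightarrow> x \<rightarrow> (y \<leadsto> z) = y \<leadsto> (x \<rightarrow> z)"
    and one_iff: "\<lbrakk>x \<in> A; y \<in> A\<rbrakk> \<Longrightarrow> x \<rightarrow> y = \<one> \<longleftrightarrow> x \<leadsto> y = \<one>"
begin

definition join1 :: "'a \<Rightarrow> 'a \<Rightarrow> 'a" (infixl "\<squnion>\<^sub>1" 65) where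
  "x \<squnion>\<^sub>1 y = (x \<rightarrow> y) \<leadsto> y"

definition join2 :: "'a \<Rightarrow> 'a \<Rightarrow> 'a" (infixl "\<squnion>\<^sub>2" 65) where
  "x \<squnion>\<^sub>2 y = (x \<leadsto> y) \<rightarrow> y"

definition deductive_system :: "'a set \<Rightarrow> bool" where
  "deductive_system D \<longleftrightarrow>
     D \<subseteq> A \<and> \<one> \<in> D \<and> (\<forall>x\<in>A. \<forall>y\<in>A. x \<in> D \<longrightarrow> x \<rightarrow> y \<in> D \<longrightarrow> y \<in> D)"

definition fantastic :: "'a set \<Rightarrow> bool" where
  "fantastic D \<longleftrightarrow> deductive_system D \<and>
     (\<forall>x\<in>A. \<forall>y\<in>A.
        (y \<rightarrow> x \<in> D \<longrightarrow> (x \<squnion>\<^sub>1 y) \<rightarrow> x \<in> D) \<and>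
        (y \<leadsto> x \<in> D \<longrightarrow> (x \<squnion>\<^sub>2 y) \<leadsto> x \<in> D))"

definition DS :: "'a set set" where
  "DS = {D. deductive_system D}"

definition DS_f :: "'a set set" where
  "DS_f = {D. fantastic D}"

end

locale commutative_pseudo_BE_algebra = pseudo_BE_algebra +
  assumes join1_commute: "\<lbrakk>x \<in> A; y \<in> A\<rbrakk> \<Longrightarrow> x \<squnion>\<^sub>1 y = y \<squnion>\<^sub>1 x"
    and join2_commute: "\<lbrakk>x \<in> A; y \<in> A\<rbrakk> \<Longrightarrow> x \<squnion>\<^sub>2 y = y \<squnion>\<^sub>2 x"

end

theory Submission
  imports Defs
begin

text \<open>
  Exchange gives \<open>x \<leadsto> (y \<rightarrow> x) = y \<rightarrow> (x \<leadsto> x) = \<one>\<close>, so by commutativity both joins of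
  \<open>y \<rightarrow> x\<close> with \<open>x\<close> collapse to \<open>y \<rightarrow> x\<close>.  Consequently
  \<open>(x \<squnion>\<^sub>1 y) \<rightarrow> x = (y \<squnion>\<^sub>1 x) \<rightarrow> x = (y \<rightarrow> x) \<squnion>\<^sub>2 x = y \<rightarrow> x\<close>, and dually with the two
  implications swapped: premise and conclusion of the fantastic condition are the same element.
\<close>

context commutative_pseudo_BE_algebra
begin

lemma join1_rimp_eq:
  assumes "x \<in> A" "y \<in> A"
  shows "(x \<squnion>\<^sub>1 y) \<rightarrow> x = y \<rightarrow> x"
proof -
  have "(x \<squnion>\<^sub>1 y) \<rightarrow> x = (y \<squnion>\<^sub>1 x) \<rightarrow> x"
    using assms by (simp add: join1_commute)
  \<comment> \<open>Both sides unfold to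
    \<open>((y \<rightarrow> x) \<leadsto> x) \<rightarrow> x\<close>.\<close>
  also have "\<dots> = (y \<rightarrow> x) \<squnion>\<^sub>2 x"
    by (simp add: join1_def join2_def)
  also have "\<dots> = x \<squnion>\<^sub>2 (y \<rightarrow> x)"
    using assms by (simp add: join2_commute rimp_closed)
  also have "\<dots> = (y \<rightarrow> (x \<leadsto> x)) \<rightarrow> (y \<rightarrow> x)"
    using assms by (simp add: join2_def exchange)
  also have "\<dots> = y \<rightarrow> x"
    using assms by (simp add: limp_refl rimp_one one_rimp rimp_closed)
  finally show ?thesis .
qed

lemma join2_limp_eq:
  assumes "x \<in> A" "y \<in> A"
  shows "(x \<squnion>\<^sub>2 y) \<leadsto> x = y \<leadsto> x"
proof -
  have "(x \<squnion>\<^sub>2 y) \<leadsto> x = (y \<squnion>\<^sub>2 x) \<leadsto> x"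
    using assms by (simp add: join2_commute)
  also have "\<dots> = (y \<leadsto> x) \<squnion>\<^sub>1 x"
    by (simp add: join1_def join2_def)
  also have "\<dots> = x \<squnion>\<^sub>1 (y \<leadsto> x)"
    using assms by (simp add: join1_commute limp_closed)
  \<comment> \<open>Exchange brings the two copies of \<open>x\<close> together, so that reflexivity
    makes the antecedent \<open>\<one>\<close>.\<close>
  also have "\<dots> = (y \<leadsto> (x \<rightarrow> x)) \<leadsto> (y \<leadsto> x)"
    using assms by (simp add: join1_def exchange)
  also have "\<dots> = y \<leadsto> x"
    using assms by (simp add: rimp_refl limp_one one_limp limp_closed)
  finally show ?thesis .
qed

lemma fantastic_iff_deductive_system: "fantastic D \<longleftrightarrow> deductive_system D"
  \<comment> \<open>The bounded quantifiers supply the carrier conditions of both equations; each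
    implication becomes trivial.\<close>
  by (simp add: fantastic_def join1_rimp_eq join2_limp_eq)

lemma DS_eq_DS_f: "DS = DS_f"
  by (simp add: DS_def DS_f_def fantastic_iff_deductive_system)

end

text \<open>\<open>DS\<close> takes no \<open>limp\<close> because deductive systems are defined
  through \<open>\<rightarrow>\<close> alone.\<close>

theorem theorem5p6:
  fixes A :: "'a set"
    and rimp limp :: "'a \<Rightarrow> 'a \<Rightarrow> 'a"
    and one :: 'a
  assumes "commutative_pseudo_BE_algebra A rimp limp one"
  shows "pseudo_BE_algebra.DS A rimp one = pseudo_BE_algebra.DS_f A rimp limp one"
  using assms by (rule commutative_pseudo_BE_algebra.DS_eq_DS_f)

end
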